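(* Let $\Bbbk$ be a field, let $n>1$, and let $R=\Bbbk\langle x_1,\dots,x_n\rangle$ be the free associative unital $\Bbbk$-algebra. For every $r\ge 1$, $D^r_{\Bbbk}(R)$ is generated as a left $D^0_{\Bbbk}(R)$-module by the set $$\{\partial_I^J \mid I=(i_1,\dots,i_s),\ J=(a_1,\dots,a_s),\ i_j\in\mathbb N,\ 1\le i_j\le n,\ a_j\in R,\ 1\le s\le r\}\cup\{\lambda_1\},$$ where $\lambda_1$ is the identity map of $R$.
   Context: Differential operators (Lunts–Rosenberg): $\mathrm{Hom}_{\Bbbk}(R,R)$ is an $R$-bimodule via $(r\varphi)(s)=r\varphi(s)$ and $(\varphi r)(s)=\varphi(rs)$. For $r\in R$ put $[\varphi,r]=\varphi r-r\varphi$. Set $D^{-1}_{\Bbbk}(R)=0$ and, for $m\ge 0$, let $D^m_{\Bbbk}(R)$ be the $R$-subbimodule of $\mathrm{Hom}_{\Bbbk}(R,R)$ generated by all $\varphi$ such that $[\varphi,r]\in D^{m-1}_{\Bbbk}(R)$ for every $r\in R$. Composition satisfies $D^i_{\Bbbk}(R)D^j_{\Bbbk}(R)\subset D^{i+j}_{\Bbbk}(R)$; $D^0_{\Bbbk}(R)$ is the algebra generated by the left multiplications $\lambda_r(s)=rs$ and right multiplications $\rho_r(s)=sr$, $r\in R$, and it acts on $D^m_{\Bbbk}(R)$ by left composition. Operators $\partial_I^J$: for $i\le n$, $a\in R$, $\partial_i^a$ is the $\Bbbk$-linear derivation of $R$ with $\partial_i^a(x_j)=\delta_{i,j}a$; for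 length-one sequences $\partial_{(i)}^{(a)}=\partial_i^a$. For $s\ge 2$, $I=(i_1,\dots,i_s)$ with $1\le i_j\le n$, and $J=(a_1,\dots,a_s)$ with $a_j\in R$, put $\widehat I=(i_2,\dots,i_s)$, $\widehat J=(a_2,\dots,a_s)$; $\partial_I^J\in D^s_{\Bbbk}(R)$ is the unique $\Bbbk$-linear operator with $[\partial_I^J,x_{i_1}]=a_1\partial_{\widehat I}^{\widehat J}$, $[\partial_I^J,x_l]=0$ for $l\ne i_1$, and $\partial_I^J(1)=0$. *)

theory Defs
  imports Complex_Main "HOL-Library.Poly_Mapping" "HOL-Library.Cardinality"
begin

text \<open>
  Words over an alphabet form the free monoid. The product of the ring type
  \<open>'a \<Rightarrow>\<^sub>0 'b\<close> is the convolution product with respect to the additively written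
  monoid \<open>'a\<close>, so concatenation is written as (noncommutative) addition.
\<close>

instantiation list :: (type) monoid_add
begin

definition zero_list :: "'a list" where "zero_list = []"

definition plus_list :: "'a list \<Rightarrow> 'a list \<Rightarrow> 'a list" where "plus_list = (@)"

instance by standard (simp_all add: zero_list_def plus_list_def)

end

text \<open>
  The free associative unital algebra over the field \<open>'k\<close> on the variables \<open>fvar j\<close>, one for
  each \<open>j :: 'n\<close>. For a finite index type \<open>'n\<close> the number of variables is \<open>CARD('n)\<close>.
\<close>

type_synonym ('k, 'n) free_alg = "'n list \<Rightarrow>\<^sub>0 'k"

definition fvar :: "'n \<Rightarrow> ('k::field, 'n) free_alg"
  where "fvar j = Poly_Mapping.single [j] 1"

definition fscale :: "'k::field \<Rightarrow> ('k, 'n) free_alg \<Rightarrow> ('k, 'n) free_alg"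
  where "fscale c p = Poly_Mapping.map ((*) c) p"

definition linear_ops :: "(('k::field, 'n) free_alg \<Rightarrow> ('k, 'n) free_alg) set"
  where "linear_ops = {\<phi>. Vector_Spaces.linear fscale fscale \<phi>}"

definition lmult :: "('k::field, 'n) free_alg \<Rightarrow> ('k, 'n) free_alg \<Rightarrow> ('k, 'n) free_alg"
  where "lmult a = (\<lambda>s. a * s)"


subsection \<open>Differential operators\<close>

definition bracket ::
    "(('k::field, 'n) free_alg \<Rightarrow> ('k, 'n) free_alg) \<Rightarrow> ('k, 'n) free_alg \<Rightarrow>
      ('k, 'n) free_alg \<Rightarrow> ('k, 'n) free_alg"
  where "bracket \<phi> a = (\<lambda>s. \<phi> (a * s) - a * \<phi> s)"

text \<open>
  In the bimodule of linear operators both actions are induced by left multiplications: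
  \<open>a\<phi>\<close> is \<open>s \<mapsto> a * \<phi> s\<close> and \<open>\<phi>a\<close> is \<open>s \<mapsto> \<phi> (a * s)\<close>.
\<close>

definition subbimodule :: "(('k::field, 'n) free_alg \<Rightarrow> ('k, 'n) free_alg) set \<Rightarrow> bool"
  where "subbimodule M \<longleftrightarrow>
    M \<subseteq> linear_ops \<and>
    (\<lambda>_. 0) \<in> M \<and>
    (\<forall>\<phi>\<in>M. \<forall>\<psi>\<in>M. (\<lambda>s. \<phi> s + \<psi> s) \<in> M) \<and>
    (\<forall>\<phi>\<in>M. (\<lambda>s. - \<phi> s) \<in> M) \<and>
    (\<forall>a. \<forall>\<phi>\<in>M. (\<lambda>s. a * \<phi> s) \<in> M) \<and>
    (\<forall>a. \<forall>\<phi>\<in>M. (\<lambda>s. \<phi> (a * s)) \<in> M)"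

definition diff_step ::
    "(('k::field, 'n) free_alg \<Rightarrow> ('k, 'n) free_alg) set \<Rightarrow>
      (('k, 'n) free_alg \<Rightarrow> ('k, 'n) free_alg) set"
  where "diff_step N = subbimodule hull {\<phi> \<in> linear_ops. \<forall>a. bracket \<phi> a \<in> N}"

text \<open>The filtration starts in degree \<open>-1\<close> with the zero module, hence the first equation.\<close>

primrec diff_ops :: "nat \<Rightarrow> (('k::field, 'n) free_alg \<Rightarrow> ('k, 'n) free_alg) set"
  where
    "diff_ops 0 = diff_step {\<lambda>_. 0}"
  | "diff_ops (Suc m) = diff_step (diff_ops m)"

text \<open>Left submodules of the module of linear operators over the algebra \<open>diff_ops 0\<close>,
  which acts by composition.\<close>

definition left_D0_submodule :: "(('k::field, 'n) free_alg \<Rightarrow> ('k, 'n) free_alg) set \<Rightarrow> bool"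
  where "left_D0_submodule M \<longleftrightarrow>
    M \<subseteq> linear_ops \<and>
    (\<lambda>_. 0) \<in> M \<and>
    (\<forall>\<phi>\<in>M. \<forall>\<psi>\<in>M. (\<lambda>s. \<phi> s + \<psi> s) \<in> M) \<and>
    (\<forall>\<phi>\<in>M. (\<lambda>s. - \<phi> s) \<in> M) \<and>
    (\<forall>\<delta>\<in>diff_ops 0. \<forall>\<phi>\<in>M. \<delta> \<circ> \<phi> \<in> M)"


subsection \<open>The iterated partial derivatives\<close>

definition is_pderiv ::
    "'n \<Rightarrow> ('k::field, 'n) free_alg \<Rightarrow> (('k, 'n) free_alg \<Rightarrow> ('k, 'n) free_alg) \<Rightarrow> bool"
  where "is_pderiv i a \<delta> \<longleftrightarrow>
    \<delta> \<in> linear_ops \<and>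
    (\<forall>p q. \<delta> (p * q) = \<delta> p * q + p * \<delta> q) \<and>
    (\<forall>j. \<delta> (fvar j) = (if i = j then a else 0))"

definition is_pderiv_step ::
    "'n \<Rightarrow> ('k::field, 'n) free_alg \<Rightarrow> (('k, 'n) free_alg \<Rightarrow> ('k, 'n) free_alg) \<Rightarrow>
      (('k, 'n) free_alg \<Rightarrow> ('k, 'n) free_alg) \<Rightarrow> bool"
  where "is_pderiv_step i a \<psi> \<phi> \<longleftrightarrow>
    \<phi> \<in> linear_ops \<and>
    bracket \<phi> (fvar i) = (\<lambda>s. a * \<psi> s) \<and>
    (\<forall>l. l \<noteq> i \<longrightarrow> bracket \<phi> (fvar l) = (\<lambda>_. 0)) \<and>
    \<phi> 1 = 0"

text \<open>
  The operator \<open>pdiff I J\<close> is only meaningful for nonempty sequences of equal length.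
  Existence and uniqueness of the operators described below are
  \<open>ex1_is_pderiv\<close> and \<open>ex1_is_pderiv_step\<close>.
\<close>

fun pdiff ::
    "'n list \<Rightarrow> ('k::field, 'n) free_alg list \<Rightarrow> ('k, 'n) free_alg \<Rightarrow> ('k, 'n) free_alg"
  where
    "pdiff [i] [a] = (THE \<delta>. is_pderiv i a \<delta>)"
  | "pdiff (i # i' # I) (a # a' # J) = (THE \<phi>. is_pderiv_step i a (pdiff (i' # I) (a' # J)) \<phi>)"


subsection \<open>Well-definedness\<close>

lemma lookup_fscale [simp]: "Poly_Mapping.lookup (fscale c p) w = c * Poly_Mapping.lookup p w"
  by (simp add: fscale_def map.rep_eq when_def)

lemma fscale_single [simp]: "fscale c (Poly_Mapping.single w d) = Poly_Mapping.single w (c * d)"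
  by (simp add: fscale_def)

lemma vector_space_fscale:
  "vector_space (fscale :: 'k::field \<Rightarrow> ('k, 'n) free_alg \<Rightarrow> ('k, 'n) free_alg)"
  by standard (auto intro!: poly_mapping_eqI simp: lookup_add algebra_simps)

interpretation fa: vector_space "fscale :: 'k::field \<Rightarrow> ('k, 'n) free_alg \<Rightarrow> ('k, 'n) free_alg"
  by (rule vector_space_fscale)

lemma free_alg_induct [case_names zero single add]:
  fixes p :: "('k::field, 'n) free_alg"
  assumes "P 0" "\<And>w c. P (Poly_Mapping.single w c)" "\<And>p q. P p \<Longrightarrow> P q \<Longrightarrow> P (p + q)"
  shows "P p"
proof -
  have sums: "P (\<Sum>w\<in>A. Poly_Mapping.single w (Poly_Mapping.lookup p w))" if "finite A" for A
    using that by (induction A rule: finite_induct) (auto simp: assms)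
  have "p = (\<Sum>w\<in>Poly_Mapping.keys p. Poly_Mapping.single w (Poly_Mapping.lookup p w))"
    by (rule poly_mapping_eqI)
      (auto simp: lookup_sum lookup_single when_def in_keys_iff sum.delta)
  with sums[of "Poly_Mapping.keys p"] show ?thesis by simp
qed

lemma fscale_eq_mult: "fscale c p = Poly_Mapping.single 0 c * p"
  by (induction p rule: free_alg_induct)
    (simp_all add: mult_single fa.scale_right_distrib distrib_left)

lemma mult_fscale_left: "fscale c p * q = fscale c (p * q)"
  by (simp add: fscale_eq_mult mult.assoc)

lemma mult_fscale_right: "p * fscale c q = fscale c (p * q)"
proof -
  have "p * Poly_Mapping.single 0 c = Poly_Mapping.single 0 c * p"
    by (induction p rule: free_alg_induct)
      (simp_all add: mult_single distrib_left distrib_right mult.commute)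
  then show ?thesis
    by (simp add: fscale_eq_mult mult.assoc[symmetric])
qed

lemma linear_ops_iff:
  "\<phi> \<in> linear_ops \<longleftrightarrow>
    (\<forall>p q. \<phi> (p + q) = \<phi> p + \<phi> q) \<and> (\<forall>c p. \<phi> (fscale c p) = fscale c (\<phi> p))"
  by (auto simp: linear_ops_def linear_iff_module_hom module_hom_iff fa.module_axioms)

lemma linear_ops_eqI:
  assumes "\<phi> \<in> linear_ops" "\<psi> \<in> linear_ops"
    and "\<And>w. \<phi> (Poly_Mapping.single w 1) = \<psi> (Poly_Mapping.single w 1)"
  shows "\<phi> = \<psi>"
proof
  fix p
  have s: "\<phi> (Poly_Mapping.single w c) = \<psi> (Poly_Mapping.single w c)" for w c
  proof -
    have "\<phi> (fscale c (Poly_Mapping.single w 1)) = \<psi> (fscale c (Poly_Mapping.single w 1))"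
      using assms by (simp add: linear_ops_iff del: fscale_single)
    then show ?thesis by simp
  qed
  show "\<phi> p = \<psi> p"
    using assms s[of 0 0]
    by (induction p rule: free_alg_induct) (auto simp: linear_ops_iff s)
qed

lemma ex_linear_op:
  fixes W :: "'n list \<Rightarrow> ('k::field, 'n) free_alg"
  obtains \<phi> where "\<phi> \<in> linear_ops" "\<And>w. \<phi> (Poly_Mapping.single w 1) = W w"
proof
  define \<phi> :: "('k, 'n) free_alg \<Rightarrow> ('k, 'n) free_alg"
    where "\<phi> p = (\<Sum>w\<in>Poly_Mapping.keys p. fscale (Poly_Mapping.lookup p w) (W w))" for p
  have on: "\<phi> p = (\<Sum>w\<in>A. fscale (Poly_Mapping.lookup p w) (W w))"
    if "finite A" "Poly_Mapping.keys p \<subseteq> A" for A p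
    unfolding \<phi>_def using that by (intro sum.mono_neutral_left) (auto simp: in_keys_iff)
  have "\<phi> (p + q) = \<phi> p + \<phi> q" for p q
    using on[of "Poly_Mapping.keys p \<union> Poly_Mapping.keys q"]
    by (simp add: Poly_Mapping.keys_add lookup_add fa.scale_left_distrib sum.distrib)
  moreover have "\<phi> (fscale c p) = fscale c (\<phi> p)" for c p
    using on[of "Poly_Mapping.keys p" "fscale c p"] on[of "Poly_Mapping.keys p" p]
    by (auto simp: fa.scale_sum_right in_keys_iff subset_iff)
  ultimately show "\<phi> \<in> linear_ops"
    by (simp add: linear_ops_iff)
  show "\<phi> (Poly_Mapping.single w 1) = W w" for w
    by (simp add: \<phi>_def)
qed

lemma fvar_mult_single:
  "fvar j * Poly_Mapping.single w c = Poly_Mapping.single (j # w) c"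
  by (simp add: fvar_def mult_single plus_list_def)

lemma single_Nil: "Poly_Mapping.single [] 1 = 1"
  by (simp add: zero_list_def[symmetric])

text \<open>A linear operator is determined by its brackets with the variables and its value at \<open>1\<close>,
  and these data can be prescribed.\<close>

lemma linear_op_unique:
  fixes \<phi> \<phi>' :: "('k::field, 'n) free_alg \<Rightarrow> ('k, 'n) free_alg"
  assumes "\<phi> \<in> linear_ops" "\<phi>' \<in> linear_ops" "\<phi> 1 = \<phi>' 1"
    and "\<And>j. bracket \<phi> (fvar j) = bracket \<phi>' (fvar j)"
  shows "\<phi> = \<phi>'"
proof (rule linear_ops_eqI[OF assms(1,2)])
  fix w
  show "\<phi> (Poly_Mapping.single w 1) = \<phi>' (Poly_Mapping.single w 1)"
  proof (induction w)
    case Nil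
    then show ?case using assms(3) by (simp add: single_Nil)
  next
    case (Cons j w)
    have "bracket \<phi> (fvar j) (Poly_Mapping.single w 1) =
        bracket \<phi>' (fvar j) (Poly_Mapping.single w 1)"
      using assms(4) by simp
    then show ?case
      using Cons by (simp add: bracket_def fvar_mult_single)
  qed
qed

lemma linear_op_exists:
  fixes \<psi> :: "'n \<Rightarrow> ('k::field, 'n) free_alg \<Rightarrow> ('k, 'n) free_alg"
  assumes "\<And>j. \<psi> j \<in> linear_ops"
  obtains \<phi> where "\<phi> \<in> linear_ops" "\<phi> 1 = c" "\<And>j. bracket \<phi> (fvar j) = \<psi> j"
proof -
  define W where "W = rec_list c (\<lambda>j w v. \<psi> j (Poly_Mapping.single w 1) + fvar j * v)"
  obtain \<phi> where \<phi>: "\<phi> \<in> linear_ops" "\<And>w. \<phi> (Poly_Mapping.single w 1) = W w"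
    using ex_linear_op[of W] by blast
  have "bracket \<phi> (fvar j) = \<psi> j" for j
  proof (rule linear_ops_eqI)
    show "bracket \<phi> (fvar j) \<in> linear_ops"
      using \<phi>(1)
      by (auto simp: linear_ops_iff bracket_def distrib_left mult_fscale_right
          fa.scale_right_diff_distrib)
    show "bracket \<phi> (fvar j) (Poly_Mapping.single w 1) = \<psi> j (Poly_Mapping.single w 1)" for w
      by (simp add: bracket_def fvar_mult_single \<phi>(2) W_def)
  qed (rule assms)
  moreover have "\<phi> 1 = c"
    using \<phi>(2)[of "[]"] by (simp add: single_Nil W_def)
  ultimately show ?thesis
    using that \<phi>(1) by blast
qed

lemma ex1_is_pderiv_step:
  assumes "\<psi> \<in> linear_ops"
  shows "\<exists>!\<phi>. is_pderiv_step i a \<psi> \<phi>"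
proof -
  define \<chi> where "\<chi> j = (if j = i then \<lambda>s. a * \<psi> s else (\<lambda>_. 0))" for j
  have "\<chi> j \<in> linear_ops" for j
    using assms by (cases "j = i") (simp_all add: \<chi>_def linear_ops_iff distrib_left mult_fscale_right)
  then obtain \<phi> where \<phi>: "\<phi> \<in> linear_ops" "\<phi> 1 = 0" "\<And>j. bracket \<phi> (fvar j) = \<chi> j"
    using linear_op_exists[of \<chi> 0] by metis
  show ?thesis
  proof (rule ex1I)
    show "is_pderiv_step i a \<psi> \<phi>"
      using \<phi> by (simp add: is_pderiv_step_def \<chi>_def)
  next
    fix \<phi>'
    assume *: "is_pderiv_step i a \<psi> \<phi>'"
    have "bracket \<phi>' (fvar j) = \<chi> j" for j
      using * by (cases "j = i") (simp_all add: is_pderiv_step_def \<chi>_def)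
    then show "\<phi>' = \<phi>"
      using * \<phi> by - (rule linear_op_unique, simp_all add: is_pderiv_step_def)
  qed
qed

lemma is_pderiv_iff_step: "is_pderiv i a \<delta> \<longleftrightarrow> is_pderiv_step i a (\<lambda>s. s) \<delta>"
proof
  assume d: "is_pderiv i a \<delta>"
  then have "\<delta> (1 * 1) = \<delta> 1 * 1 + 1 * \<delta> 1"
    unfolding is_pderiv_def by blast
  then have "\<delta> 1 = 0" by simp
  with d show "is_pderiv_step i a (\<lambda>s. s) \<delta>"
    by (auto simp: is_pderiv_def is_pderiv_step_def bracket_def)
next
  assume d: "is_pderiv_step i a (\<lambda>s. s) \<delta>"
  then have lin: "\<delta> \<in> linear_ops" and one: "\<delta> 1 = 0"
    by (simp_all add: is_pderiv_step_def)
  have add: "\<delta> (p + q) = \<delta> p + \<delta> q" and scale: "\<delta> (fscale c p) = fscale c (\<delta> p)" for p q c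
    using lin by (simp_all add: linear_ops_iff)
  have zero: "\<delta> 0 = 0"
    using add[of 0 0] by simp
  have step: "\<delta> (fvar j * s) = (if j = i then a * s else 0) + fvar j * \<delta> s" for j s
  proof -
    have "bracket \<delta> (fvar j) s = (if j = i then a * s else 0)"
      using d by (auto simp: is_pderiv_step_def)
    then show ?thesis
      unfolding bracket_def by (simp add: algebra_simps)
  qed
  have var: "\<delta> (fvar j) = (if i = j then a else 0)" for j
    using step[of j 1] one by auto
  have word: "\<delta> (Poly_Mapping.single w 1 * q) =
      \<delta> (Poly_Mapping.single w 1) * q + Poly_Mapping.single w 1 * \<delta> q" for w q
  proof (induction w)
    case Nil
    then show ?case by (simp add: single_Nil one)
  next
    case (Cons j w)
    then show ?case
      by (simp add: fvar_mult_single[symmetric] mult.assoc step algebra_simps)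
  qed
  have "\<delta> (p * q) = \<delta> p * q + p * \<delta> q" for p q
  proof (induction p rule: free_alg_induct)
    case (single w c)
    have "\<delta> (fscale c (Poly_Mapping.single w 1) * q) =
        \<delta> (fscale c (Poly_Mapping.single w 1)) * q + fscale c (Poly_Mapping.single w 1) * \<delta> q"
      by (simp only: mult_fscale_left scale word fa.scale_right_distrib)
    then show ?case by simp
  qed (simp_all add: zero add algebra_simps)
  with lin var show "is_pderiv i a \<delta>"
    unfolding is_pderiv_def by blast
qed

lemma ex1_is_pderiv: "\<exists>!\<delta>. is_pderiv i a \<delta>"
  unfolding is_pderiv_iff_step by (rule ex1_is_pderiv_step) (simp add: linear_ops_iff)

lemma is_pderiv_pdiff: "is_pderiv i a (pdiff [i] [a])"
  using theI'[OF ex1_is_pderiv[of i a]] by simp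

lemma is_pderiv_step_pdiff_aux:
  assumes "pdiff (i' # I) (a' # J) \<in> linear_ops"
  shows "is_pderiv_step i a (pdiff (i' # I) (a' # J)) (pdiff (i # i' # I) (a # a' # J))"
  using theI'[OF ex1_is_pderiv_step[OF assms, of i a]] by simp

lemma pdiff_linear:
  assumes "length I = length J" "I \<noteq> []"
  shows "pdiff I J \<in> linear_ops"
  using assms
proof (induction I J rule: pdiff.induct)
  case (1 i a)
  show ?case
    using is_pderiv_pdiff[of i a] unfolding is_pderiv_def by blast
next
  case (2 i i' I a a' J)
  then have "pdiff (i' # I) (a' # J) \<in> linear_ops" by simp
  from is_pderiv_step_pdiff_aux[OF this, of i a] show ?case
    unfolding is_pderiv_step_def by blast
qed simp_all

lemma is_pderiv_step_pdiff:
  assumes "length I = length J" "I \<noteq> []"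
  shows "is_pderiv_step i a (pdiff I J) (pdiff (i # I) (a # J))"
proof -
  obtain i' I' a' J' where eq: "I = i' # I'" "J = a' # J'"
    using assms by (metis length_0_conv neq_Nil_conv)
  show ?thesis
    using pdiff_linear[OF assms] unfolding eq by (rule is_pderiv_step_pdiff_aux)
qed

end

theory Submission
  imports Defs
begin

text \<open>
  Call an operator \<open>\<phi>\<close> a principal operator of order at most \<open>m\<close> if all brackets of \<open>\<phi>\<close> have order
  at most \<open>m - 1\<close>; these generate \<open>D\<^sup>m\<close> as a bimodule. Since a linear operator on the free
  algebra is determined by its value at \<open>1\<close> and its brackets with the variables, and these data
  are arbitrary, \<open>\<phi>\<close> can be integrated back from its brackets. With \<open>\<lambda>\<^sub>a\<close> and \<open>\<rho>\<^sub>b\<close> for left and right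
  multiplications, \<open>\<phi> = \<rho>\<^bsub>\<phi>(1)\<^esub> + (\<Sum>i. T\<^sub>i [\<phi>, x\<^sub>i])\<close>, where \<open>T\<^sub>i \<psi>\<close> is the operator that kills \<open>1\<close>,
  has bracket \<open>\<psi>\<close> with \<open>x\<^sub>i\<close>, and commutes with left multiplication by the other variables
  (\<open>bracket_decomposition\<close>).

  By induction on the order, \<open>[\<phi>, x\<^sub>i]\<close> is a sum of terms \<open>\<lambda>\<^sub>a \<rho>\<^sub>b \<partial>\<close> with \<open>\<partial>\<close> an iterated partial
  derivative of order at most \<open>m - 1\<close> or the identity. Integration commutes with right
  multiplications, and integrating \<open>\<lambda>\<^sub>a \<partial>\<close> along \<open>x\<^sub>i\<close> is by definition the next iterated partial
  derivative, so \<open>T\<^sub>i(\<lambda>\<^sub>a \<rho>\<^sub>b \<partial>\<^sub>I\<^sup>J) = \<rho>\<^sub>b \<partial>\<^bsub>iI\<^esub>\<^bsup>aJ\<^esup>\<close>. This is \<open>integrate_hull\<close>, and it puts all principal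
  operators into the \<open>D\<^sup>0\<close>-module spanned by the iterated partial derivatives and the identity.

  That module is also stable under the right action of \<open>R\<close> (\<open>hull_right_action\<close>): moving \<open>a\<close> past a
  generator costs a bracket, which has lower order. Hence it contains \<open>D\<^sup>m\<close>. The
  other inclusion holds because \<open>D\<^sup>m\<close> is stable under right multiplications and because the
  brackets with all of \<open>R\<close> are controlled by those with the variables (\<open>bracket_from_variables\<close>).
\<close>

section \<open>Operators, multiplications and brackets\<close>

definition rmult :: "('k::field, 'n) free_alg \<Rightarrow> ('k, 'n) free_alg \<Rightarrow> ('k, 'n) free_alg"
  where "rmult b = (\<lambda>s. s * b)"

lemma linear_opsD:
  assumes "\<phi> \<in> linear_ops"
  shows "\<phi> (p + q) = \<phi> p + \<phi> q" "\<phi> (fscale c p) = fscale c (\<phi> p)" "\<phi> 0 = 0"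
proof -
  interpret Vector_Spaces.linear fscale fscale \<phi>
    using assms by (simp add: linear_ops_def)
  show "\<phi> (p + q) = \<phi> p + \<phi> q" "\<phi> (fscale c p) = fscale c (\<phi> p)" "\<phi> 0 = 0"
    by (rule add scale zero)+
qed

lemma linear_ops_closed:
  shows linear_ops_zero: "(\<lambda>_. 0) \<in> linear_ops"
    and linear_ops_id: "(\<lambda>s. s) \<in> linear_ops"
    and linear_ops_add: "\<phi> \<in> linear_ops \<Longrightarrow> \<psi> \<in> linear_ops \<Longrightarrow> (\<lambda>s. \<phi> s + \<psi> s) \<in> linear_ops"
    and linear_ops_minus: "\<phi> \<in> linear_ops \<Longrightarrow> (\<lambda>s. - \<phi> s) \<in> linear_ops"
    and linear_ops_left: "\<phi> \<in> linear_ops \<Longrightarrow> (\<lambda>s. a * \<phi> s) \<in> linear_ops"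
    and linear_ops_right: "\<phi> \<in> linear_ops \<Longrightarrow> (\<lambda>s. \<phi> (a * s)) \<in> linear_ops"
    and linear_ops_rmult: "\<phi> \<in> linear_ops \<Longrightarrow> (\<lambda>s. \<phi> s * b) \<in> linear_ops"
    and linear_ops_comp: "\<delta> \<in> linear_ops \<Longrightarrow> \<phi> \<in> linear_ops \<Longrightarrow> \<delta> \<circ> \<phi> \<in> linear_ops"
  by (auto simp: linear_ops_iff algebra_simps mult_fscale_right mult_fscale_left
      fa.scale_right_distrib)

lemma linear_ops_bracket: "\<phi> \<in> linear_ops \<Longrightarrow> bracket \<phi> a \<in> linear_ops"
  by (auto simp: linear_ops_iff bracket_def algebra_simps mult_fscale_right
      fa.scale_right_diff_distrib)

lemma bracket_mult:
  "bracket \<phi> (a * b) = (\<lambda>s. bracket \<phi> a (b * s) + a * bracket \<phi> b s)"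
  by (simp add: bracket_def fun_eq_iff algebra_simps)

section \<open>Sub-bimodules and left submodules\<close>

lemma subbimoduleI:
  assumes "M \<subseteq> linear_ops" "(\<lambda>_. 0) \<in> M"
    "\<And>\<phi> \<psi>. \<phi> \<in> M \<Longrightarrow> \<psi> \<in> M \<Longrightarrow> (\<lambda>s. \<phi> s + \<psi> s) \<in> M"
    "\<And>\<phi>. \<phi> \<in> M \<Longrightarrow> (\<lambda>s. - \<phi> s) \<in> M"
    "\<And>a \<phi>. \<phi> \<in> M \<Longrightarrow> (\<lambda>s. a * \<phi> s) \<in> M"
    "\<And>a \<phi>. \<phi> \<in> M \<Longrightarrow> (\<lambda>s. \<phi> (a * s)) \<in> M"
  shows "subbimodule M"
  unfolding subbimodule_def by (intro conjI ballI allI; rule assms; assumption)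

lemma subbimoduleD:
  assumes "subbimodule M"
  shows "M \<subseteq> linear_ops" "(\<lambda>_. 0) \<in> M"
    "\<phi> \<in> M \<Longrightarrow> \<psi> \<in> M \<Longrightarrow> (\<lambda>s. \<phi> s + \<psi> s) \<in> M"
    "\<phi> \<in> M \<Longrightarrow> (\<lambda>s. - \<phi> s) \<in> M"
    "\<phi> \<in> M \<Longrightarrow> (\<lambda>s. a * \<phi> s) \<in> M"
    "\<phi> \<in> M \<Longrightarrow> (\<lambda>s. \<phi> (a * s)) \<in> M"
  using assms unfolding subbimodule_def by simp_all

lemma left_D0_submoduleD:
  assumes "left_D0_submodule M"
  shows "M \<subseteq> linear_ops" "(\<lambda>_. 0) \<in> M"
    "\<phi> \<in> M \<Longrightarrow> \<psi> \<in> M \<Longrightarrow> (\<lambda>s. \<phi> s + \<psi> s) \<in> M"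
    "\<phi> \<in> M \<Longrightarrow> (\<lambda>s. - \<phi> s) \<in> M"
    "\<delta> \<in> diff_ops 0 \<Longrightarrow> \<phi> \<in> M \<Longrightarrow> \<delta> \<circ> \<phi> \<in> M"
  using assms unfolding left_D0_submodule_def by simp_all

text \<open>The hull of a set with a nonlinear element would be everything, and not a sub-bimodule; this
  is why linearity of the generators is assumed.\<close>

lemma subbimodule_hull:
  assumes "S \<subseteq> linear_ops"
  shows "subbimodule (subbimodule hull S)"
proof -
  have "subbimodule linear_ops"
    by (rule subbimoduleI) (rule subset_refl linear_ops_closed; assumption)+
  then have "subbimodule hull S \<subseteq> linear_ops"
    using assms by (intro hull_minimal)
  then show ?thesis
    by (intro subbimoduleI) (auto simp: hull_def intro: subbimoduleD)
qed

lemma subbimodule_diff_step: "subbimodule (diff_step N)"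
  unfolding diff_step_def by (rule subbimodule_hull) auto

lemma subbimodule_diff_ops: "subbimodule (diff_ops m)"
  by (cases m) (simp_all add: subbimodule_diff_step)

lemma diff_ops_linear: "\<phi> \<in> diff_ops m \<Longrightarrow> \<phi> \<in> linear_ops"
  using subbimoduleD(1)[OF subbimodule_diff_ops] by blast

lemma left_D0_submodule_hull:
  assumes "S \<subseteq> linear_ops"
  shows "left_D0_submodule (left_D0_submodule hull S)"
proof -
  have "left_D0_submodule linear_ops"
    using linear_ops_zero unfolding left_D0_submodule_def
    by (auto simp: linear_ops_add linear_ops_minus linear_ops_comp diff_ops_linear
        simp del: diff_ops.simps)
  then have "left_D0_submodule hull S \<subseteq> linear_ops"
    using assms by (intro hull_minimal)
  then show ?thesis
    unfolding left_D0_submodule_def[of "left_D0_submodule hull S"]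
    by (auto simp: hull_def intro: left_D0_submoduleD)
qed

lemma left_D0_submodule_sum:
  assumes "left_D0_submodule M" "finite A" "\<And>i. i \<in> A \<Longrightarrow> f i \<in> M"
  shows "(\<lambda>s. \<Sum>i\<in>A. f i s) \<in> M"
  using assms(2,3)
  by (induction A rule: finite_induct) (auto intro: left_D0_submoduleD[OF assms(1)])

section \<open>The filtration by order\<close>

lemma diff_stepI:
  assumes "\<phi> \<in> linear_ops" "\<And>a. bracket \<phi> a \<in> N"
  shows "\<phi> \<in> diff_step N"
  unfolding diff_step_def using assms by (intro hull_inc CollectI) simp

lemma diff_step_mono: "N \<subseteq> N' \<Longrightarrow> diff_step N \<subseteq> diff_step N'"
  unfolding diff_step_def by (rule hull_mono) auto

lemma diff_ops_Suc_mono: "diff_ops m \<subseteq> diff_ops (Suc m)"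
proof (induction m)
  case 0
  show ?case
    using diff_step_mono[of "{\<lambda>_. 0}" "diff_ops 0"]
      subbimoduleD(2)[OF subbimodule_diff_ops[of 0]] by simp
qed (simp add: diff_step_mono)

lemma diff_ops_0_subset: "diff_ops 0 \<subseteq> diff_ops m"
  using lift_Suc_mono_le[of diff_ops 0 m] diff_ops_Suc_mono by blast

text \<open>The operators all of whose brackets vanish are the left module endomorphisms of \<open>R\<close>, and these
  are the right multiplications.\<close>

lemma range_rmult:
  "{\<phi> \<in> linear_ops. \<forall>a. bracket \<phi> a = (\<lambda>_. 0)} =
    range (rmult :: ('k::field, 'n) free_alg \<Rightarrow> _)"
proof (rule equalityI; rule subsetI)
  fix \<phi> :: "('k, 'n) free_alg \<Rightarrow> ('k, 'n) free_alg"
  assume "\<phi> \<in> {\<phi> \<in> linear_ops. \<forall>a. bracket \<phi> a = (\<lambda>_. 0)}"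
  then have "bracket \<phi> a 1 = 0" for a
    by simp
  then have "\<phi> a = rmult (\<phi> 1) a" for a
    unfolding bracket_def rmult_def by (metis mult_1_right eq_iff_diff_eq_0)
  then have "\<phi> = rmult (\<phi> 1)" ..
  then show "\<phi> \<in> range rmult"
    by (rule range_eqI)
next
  fix \<phi> :: "('k, 'n) free_alg \<Rightarrow> ('k, 'n) free_alg"
  assume "\<phi> \<in> range rmult"
  then obtain b where b: "\<phi> = rmult b" ..
  have "\<phi> \<in> linear_ops"
    unfolding b rmult_def by (rule linear_ops_rmult[OF linear_ops_id])
  moreover have "bracket \<phi> a = (\<lambda>_. 0)" for a
    by (simp add: b bracket_def rmult_def mult.assoc)
  ultimately show "\<phi> \<in> {\<phi> \<in> linear_ops. \<forall>a. bracket \<phi> a = (\<lambda>_. 0)}"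
    by simp
qed

lemma diff_ops_0: "diff_ops 0 = subbimodule hull (range rmult)"
  by (simp add: diff_step_def range_rmult)

lemma rmult_in_diff_ops_0: "rmult b \<in> diff_ops 0"
  unfolding diff_ops_0 by (simp add: hull_inc)

lemma id_in_diff_ops_0: "(\<lambda>s. s) \<in> diff_ops 0"
  using rmult_in_diff_ops_0[of 1] by (simp add: rmult_def)

lemma lmult_in_diff_ops_0: "lmult a \<in> diff_ops 0"
  using subbimoduleD(5)[OF subbimodule_diff_ops id_in_diff_ops_0] by (simp add: lmult_def)

lemma left_D0_submodule_left:
  assumes "left_D0_submodule M" "\<phi> \<in> M"
  shows "(\<lambda>s. a * \<phi> s) \<in> M"
  using left_D0_submoduleD(5)[OF assms(1) lmult_in_diff_ops_0[of a] assms(2)]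
  by (simp add: lmult_def comp_def)

lemma left_D0_submodule_rmult:
  assumes "left_D0_submodule M" "\<phi> \<in> M"
  shows "(\<lambda>s. \<phi> s * b) \<in> M"
  using left_D0_submoduleD(5)[OF assms(1) rmult_in_diff_ops_0[of b] assms(2)]
  by (simp add: rmult_def comp_def)

text \<open>Left multiplications, right multiplications and sums exhaust \<open>D\<^sup>0\<close>, so for a submodule it
  suffices to check stability under these.\<close>

lemma left_D0_submoduleI:
  assumes "M \<subseteq> linear_ops" "(\<lambda>_. 0) \<in> M"
    and add: "\<And>\<phi> \<psi>. \<phi> \<in> M \<Longrightarrow> \<psi> \<in> M \<Longrightarrow> (\<lambda>s. \<phi> s + \<psi> s) \<in> M"
    and minus: "\<And>\<phi>. \<phi> \<in> M \<Longrightarrow> (\<lambda>s. - \<phi> s) \<in> M"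
    and left: "\<And>a \<phi>. \<phi> \<in> M \<Longrightarrow> (\<lambda>s. a * \<phi> s) \<in> M"
    and rmult: "\<And>b \<phi>. \<phi> \<in> M \<Longrightarrow> (\<lambda>s. \<phi> s * b) \<in> M"
  shows "left_D0_submodule M"
proof -
  let ?X = "{\<delta> \<in> linear_ops. \<forall>\<phi>\<in>M. (\<lambda>s. \<delta> (\<phi> s)) \<in> M}"
  have "subbimodule ?X"
    using assms(2) by (intro subbimoduleI) (auto intro: linear_ops_closed add minus left)
  moreover have "range rmult \<subseteq> ?X"
    by (auto simp: rmult_def intro!: rmult linear_ops_rmult linear_ops_id)
  ultimately have "diff_ops 0 \<subseteq> ?X"
    unfolding diff_ops_0 by (intro hull_minimal)
  then show ?thesis
    unfolding left_D0_submodule_def comp_def using assms(1,2) add minus by auto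
qed

text \<open>Right multiplications are left linear, so \<open>[\<rho>\<^sub>b \<phi>, a] = \<rho>\<^sub>b [\<phi>, a]\<close>.\<close>

lemma diff_step_rmult:
  fixes b :: "('k::field, 'n) free_alg"
  assumes N: "\<And>\<psi>. \<psi> \<in> N \<Longrightarrow> (\<lambda>s. \<psi> s * b) \<in> N" and "\<phi> \<in> diff_step N"
  shows "(\<lambda>s. \<phi> s * b) \<in> diff_step N"
proof -
  let ?X = "{\<phi> \<in> linear_ops. (\<lambda>s. \<phi> s * b) \<in> diff_step N}"
  note D = subbimoduleD[OF subbimodule_diff_step[of N]]
  have "subbimodule ?X"
    using D(2) by (intro subbimoduleI)
      (auto simp: distrib_right mult.assoc intro: linear_ops_closed D(3) D(5)
        dest: D(4) D(6))
  moreover have "{\<phi> \<in> linear_ops. \<forall>a. bracket \<phi> a \<in> N} \<subseteq> ?X" (is "?P \<subseteq> _")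
  proof
    fix \<phi> assume \<phi>: "\<phi> \<in> ?P"
    have "bracket (\<lambda>s. \<phi> s * b) a = (\<lambda>s. bracket \<phi> a s * b)" for a
      by (simp add: bracket_def algebra_simps)
    then show "\<phi> \<in> ?X"
      using \<phi> N by (auto intro!: diff_stepI linear_ops_rmult)
  qed
  ultimately have "subbimodule hull ?P \<subseteq> ?X"
    by (intro hull_minimal)
  moreover have "\<phi> \<in> subbimodule hull ?P"
    using assms(2) by (simp only: diff_step_def)
  ultimately show ?thesis
    by blast
qed

lemma left_D0_submodule_diff_ops:
  "left_D0_submodule (diff_ops m :: (('k::field, 'n) free_alg \<Rightarrow> _) set)"
proof (rule left_D0_submoduleI)
  show "(\<lambda>s. \<phi> s * b) \<in> diff_ops m" if "\<phi> \<in> diff_ops m"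
    for \<phi> and b :: "('k, 'n) free_alg"
    using that
  proof (induction m arbitrary: \<phi>)
    case 0
    then show ?case
      using diff_step_rmult[of "{\<lambda>_. 0}" b] by simp
  next
    case (Suc m)
    then show ?case
      using diff_step_rmult[of "diff_ops m" b] by simp
  qed
qed (rule subbimoduleD(1-5)[OF subbimodule_diff_ops]; assumption?)+

text \<open>The elements \<open>a\<close> whose bracket with \<open>\<phi>\<close> lies in a sub-bimodule form a subalgebra, because
  \<open>[\<phi>, ab] = [\<phi>, a] b + a [\<phi>, b]\<close>.\<close>

lemma bracket_from_variables:
  fixes \<phi> :: "('k::field, 'n) free_alg \<Rightarrow> ('k, 'n) free_alg"
  assumes \<phi>: "\<phi> \<in> linear_ops" and N: "subbimodule N"
    and var: "\<And>j. bracket \<phi> (fvar j) \<in> N"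
  shows "bracket \<phi> a \<in> N"
proof (induction a rule: free_alg_induct)
  case zero
  then show ?case
    using subbimoduleD(2)[OF N] linear_opsD(3)[OF \<phi>] by (simp add: bracket_def)
next
  case (single w c)
  show ?case
  proof (induction w)
    case Nil
    have "Poly_Mapping.single [] c * p = fscale c p" for p :: "('k, 'n) free_alg"
      by (simp add: fscale_eq_mult zero_list_def)
    then have "bracket \<phi> (Poly_Mapping.single [] c) = (\<lambda>_. 0)"
      by (simp add: bracket_def linear_opsD(2)[OF \<phi>])
    then show ?case
      using subbimoduleD(2)[OF N] by simp
  next
    case (Cons j w)
    show ?case
      using subbimoduleD(3)[OF N subbimoduleD(6)[OF N var[of j]] subbimoduleD(5)[OF N Cons]]
      by (simp add: fvar_mult_single[symmetric] bracket_mult)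
  qed
next
  case (add a b)
  have "bracket \<phi> (a + b) = (\<lambda>s. bracket \<phi> a s + bracket \<phi> b s)"
    by (simp add: bracket_def algebra_simps linear_opsD[OF \<phi>])
  then show ?case
    using add subbimoduleD(3)[OF N] by simp
qed

section \<open>Integration along a variable\<close>

text \<open>This is \<open>T\<^sub>i (\<lambda>\<^sub>a \<psi>)\<close>. The coefficient \<open>a\<close> is a separate argument so that the recursion for
  the iterated partial derivatives is literally an integration.\<close>

definition integrate ::
    "'n \<Rightarrow> ('k::field, 'n) free_alg \<Rightarrow> (('k, 'n) free_alg \<Rightarrow> ('k, 'n) free_alg) \<Rightarrow>
      ('k, 'n) free_alg \<Rightarrow> ('k, 'n) free_alg"
  where "integrate i a \<psi> = (THE \<phi>. is_pderiv_step i a \<psi> \<phi>)"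

lemma is_pderiv_step_integrate:
  "\<psi> \<in> linear_ops \<Longrightarrow> is_pderiv_step i a \<psi> (integrate i a \<psi>)"
  unfolding integrate_def by (rule theI'[OF ex1_is_pderiv_step])

lemma integrate_unique:
  "\<psi> \<in> linear_ops \<Longrightarrow> is_pderiv_step i a \<psi> \<phi> \<Longrightarrow> integrate i a \<psi> = \<phi>"
  unfolding integrate_def by (rule the1_equality[OF ex1_is_pderiv_step])

lemma integrate_linear: "\<psi> \<in> linear_ops \<Longrightarrow> integrate i a \<psi> \<in> linear_ops"
  using is_pderiv_step_integrate[of \<psi> i a] by (simp add: is_pderiv_step_def)

lemma integrate_one: "\<psi> \<in> linear_ops \<Longrightarrow> integrate i a \<psi> 1 = 0"
  using is_pderiv_step_integrate[of \<psi> i a] by (simp add: is_pderiv_step_def)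

lemma bracket_integrate:
  assumes "\<psi> \<in> linear_ops"
  shows "bracket (integrate i a \<psi>) (fvar j) = (\<lambda>s. if j = i then a * \<psi> s else 0)"
  using is_pderiv_step_integrate[OF assms, of i a]
  by (cases "j = i") (simp_all add: is_pderiv_step_def)

text \<open>Integration is characterised by its brackets with the variables and its value at \<open>1\<close>; its
  compatibility with sums and multiplications is read off from these.\<close>

lemma integrateI:
  assumes "\<psi> \<in> linear_ops" "\<phi> \<in> linear_ops" "\<phi> 1 = 0"
    and "\<And>j s. bracket \<phi> (fvar j) s = (if j = i then a * \<psi> s else 0)"
  shows "integrate i a \<psi> = \<phi>"
  using assms by (intro integrate_unique) (auto simp: is_pderiv_step_def fun_eq_iff)

lemma integrate_zero: "integrate i a (\<lambda>_. 0) = (\<lambda>_. 0)"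
  by (rule integrateI) (auto simp: linear_ops_closed bracket_def)

lemma integrate_add:
  assumes "\<phi> \<in> linear_ops" "\<psi> \<in> linear_ops"
  shows "integrate i a (\<lambda>s. \<phi> s + \<psi> s) = (\<lambda>s. integrate i a \<phi> s + integrate i a \<psi> s)"
proof (rule integrateI)
  fix j s
  have "bracket (\<lambda>s. integrate i a \<phi> s + integrate i a \<psi> s) (fvar j) s =
      bracket (integrate i a \<phi>) (fvar j) s + bracket (integrate i a \<psi>) (fvar j) s"
    by (simp add: bracket_def algebra_simps)
  then show "bracket (\<lambda>s. integrate i a \<phi> s + integrate i a \<psi> s) (fvar j) s =
      (if j = i then a * (\<phi> s + \<psi> s) else 0)"
    using assms by (simp add: bracket_integrate distrib_left)
qed (use assms in \<open>simp_all add: linear_ops_closed integrate_linear integrate_one\<close>)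

lemma integrate_minus:
  assumes "\<psi> \<in> linear_ops"
  shows "integrate i a (\<lambda>s. - \<psi> s) = (\<lambda>s. - integrate i a \<psi> s)"
proof (rule integrateI)
  fix j s
  have "bracket (\<lambda>s. - integrate i a \<psi> s) (fvar j) s = - bracket (integrate i a \<psi>) (fvar j) s"
    by (simp add: bracket_def)
  then show "bracket (\<lambda>s. - integrate i a \<psi> s) (fvar j) s = (if j = i then a * - \<psi> s else 0)"
    using assms by (simp add: bracket_integrate)
qed (use assms in \<open>simp_all add: linear_ops_closed integrate_linear integrate_one\<close>)

lemma integrate_rmult:
  assumes "\<psi> \<in> linear_ops"
  shows "integrate i a (\<lambda>s. \<psi> s * b) = (\<lambda>s. integrate i a \<psi> s * b)"
proof (rule integrateI)
  fix j s
  have "bracket (\<lambda>s. integrate i a \<psi> s * b) (fvar j) s = bracket (integrate i a \<psi>) (fvar j) s * b"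
    by (simp add: bracket_def algebra_simps)
  then show "bracket (\<lambda>s. integrate i a \<psi> s * b) (fvar j) s =
      (if j = i then a * (\<psi> s * b) else 0)"
    using assms by (simp add: bracket_integrate mult.assoc)
qed (use assms in \<open>simp_all add: linear_ops_closed integrate_linear integrate_one\<close>)

lemma integrate_left:
  assumes "\<psi> \<in> linear_ops"
  shows "integrate i a (\<lambda>s. c * \<psi> s) = integrate i (a * c) \<psi>"
  using assms
  by (intro integrateI)
    (simp_all add: linear_ops_closed integrate_linear integrate_one bracket_integrate mult.assoc)

text \<open>Both sides take the same value at \<open>1\<close>, and the \<open>i\<close>-th summand on the right contributes the
  bracket with \<open>x\<^sub>i\<close> and no other; a right multiplication has zero brackets.\<close>

lemma bracket_decomposition:
  fixes \<phi> :: "('k::field, 'n::finite) free_alg \<Rightarrow> ('k, 'n) free_alg"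
  assumes \<phi>: "\<phi> \<in> linear_ops"
  shows "\<phi> = (\<lambda>s. s * \<phi> 1 + (\<Sum>i\<in>UNIV. integrate i 1 (bracket \<phi> (fvar i)) s))"
    (is "_ = (\<lambda>s. s * \<phi> 1 + ?S s)")
proof (rule linear_op_unique[OF \<phi>])
  note lin = linear_ops_bracket[OF \<phi>]
  have "?S \<in> linear_ops"
    using integrate_linear[OF lin]
    by (auto simp: linear_ops_iff sum.distrib fa.scale_sum_right)
  then show "(\<lambda>s. s * \<phi> 1 + ?S s) \<in> linear_ops"
    by (intro linear_ops_add linear_ops_rmult linear_ops_id)
  show "\<phi> 1 = 1 * \<phi> 1 + ?S 1"
    by (simp add: integrate_one[OF lin])
  show "bracket \<phi> (fvar j) = bracket (\<lambda>s. s * \<phi> 1 + ?S s) (fvar j)" for j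
  proof
    fix s
    have "bracket (\<lambda>s. s * \<phi> 1 + ?S s) (fvar j) s =
        (\<Sum>i\<in>UNIV. bracket (integrate i 1 (bracket \<phi> (fvar i))) (fvar j) s)"
      by (simp add: bracket_def algebra_simps sum_distrib_left sum_subtractf)
    also have "\<dots> = bracket \<phi> (fvar j) s"
      by (simp add: bracket_integrate[OF lin] sum.delta')
    finally show "bracket \<phi> (fvar j) s = bracket (\<lambda>s. s * \<phi> 1 + ?S s) (fvar j) s" ..
  qed
qed

lemma integrate_diff_ops:
  assumes "\<psi> \<in> diff_ops m"
  shows "bracket (integrate i a \<psi>) b \<in> diff_ops m"
proof (rule bracket_from_variables[OF integrate_linear subbimodule_diff_ops])
  show lin: "\<psi> \<in> linear_ops"
    by (rule diff_ops_linear[OF assms])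
  show "bracket (integrate i a \<psi>) (fvar j) \<in> diff_ops m" for j
    using subbimoduleD(2,5)[OF subbimodule_diff_ops[of m]] assms
    by (cases "j = i") (simp_all add: bracket_integrate[OF lin])
qed

section \<open>Iterated partial derivatives\<close>

definition pdiff_gens :: "nat \<Rightarrow> (('k::field, 'n) free_alg \<Rightarrow> ('k, 'n) free_alg) set"
  where "pdiff_gens r =
    {pdiff I J | I J. length I = length J \<and> 1 \<le> length I \<and> length I \<le> r} \<union> {lmult 1}"

lemma pdiff_gens_mono: "pdiff_gens r \<subseteq> pdiff_gens (Suc r)"
  unfolding pdiff_gens_def by fastforce

lemma pdiff_singleton: "pdiff [i] [a] = integrate i a (lmult 1)"
  by (simp add: integrate_def lmult_def flip: is_pderiv_iff_step)

lemma pdiff_Cons: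
  assumes "length I = length J" "I \<noteq> []"
  shows "pdiff (i # I) (a # J) = integrate i a (pdiff I J)"
  using assms by (intro integrate_unique[symmetric] pdiff_linear is_pderiv_step_pdiff)

lemma pdiff_gens_integrate:
  assumes "\<psi> \<in> pdiff_gens r"
  shows "integrate i a \<psi> \<in> pdiff_gens (Suc r)"
proof (cases "\<psi> = lmult 1")
  case True
  then have "integrate i a \<psi> = pdiff [i] [a]"
    by (simp add: pdiff_singleton del: pdiff.simps)
  moreover have "length [i] = length [a]" "1 \<le> length [i]" "length [i] \<le> Suc r"
    by simp_all
  ultimately show ?thesis
    unfolding pdiff_gens_def by blast
next
  case False
  then obtain I J where IJ: "\<psi> = pdiff I J" "length I = length J" "1 \<le> length I" "length I \<le> r"
    using assms unfolding pdiff_gens_def by blast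
  then have "integrate i a \<psi> = pdiff (i # I) (a # J)"
    using pdiff_Cons[of I J i a] by (cases "I = []") simp_all
  moreover have "length (i # I) = length (a # J)" "1 \<le> length (i # I)" "length (i # I) \<le> Suc r"
    using IJ by auto
  ultimately show ?thesis
    unfolding pdiff_gens_def by blast
qed

lemma pdiff_gens_Suc_cases:
  assumes "\<phi> \<in> pdiff_gens (Suc r)"
  obtains "\<phi> = lmult 1" | i a \<psi> where "\<psi> \<in> pdiff_gens r" "\<phi> = integrate i a \<psi>"
proof (cases "\<phi> = lmult 1")
  case False
  then obtain I J where IJ: "\<phi> = pdiff I J" "length I = length J" "1 \<le> length I"
    "length I \<le> Suc r"
    using assms unfolding pdiff_gens_def by blast
  then obtain i I' a J' where eq: "I = i # I'" "J = a # J'"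
    by (cases I; cases J) auto
  show ?thesis
  proof (cases "I' = []")
    case True
    then have "\<phi> = integrate i a (lmult 1)"
      using IJ eq pdiff_singleton[of i a] by simp
    then show ?thesis
      using that(2) unfolding pdiff_gens_def by blast
  next
    case False
    then have "\<phi> = integrate i a (pdiff I' J')"
      using IJ eq pdiff_Cons[of I' J' i a] by simp
    moreover have "pdiff I' J' \<in> pdiff_gens r"
      unfolding pdiff_gens_def using False IJ eq by (fastforce simp: Suc_le_eq)
    ultimately show ?thesis
      using that(2) by blast
  qed
qed (use that in blast)

lemma pdiff_gens_linear: "pdiff_gens r \<subseteq> linear_ops"
  unfolding pdiff_gens_def
  using diff_ops_linear[OF lmult_in_diff_ops_0] by (auto intro!: pdiff_linear)

lemma pdiff_gens_diff_ops:
  "(pdiff_gens r :: (('k::field, 'n) free_alg \<Rightarrow> _) set) \<subseteq> diff_ops r"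
proof (induction r)
  case 0
  then show ?case
    by (auto simp: pdiff_gens_def simp del: diff_ops.simps intro: lmult_in_diff_ops_0)
next
  case (Suc r)
  show ?case
  proof
    fix \<phi> :: "('k, 'n) free_alg \<Rightarrow> ('k, 'n) free_alg"
    assume "\<phi> \<in> pdiff_gens (Suc r)"
    then show "\<phi> \<in> diff_ops (Suc r)"
    proof (cases rule: pdiff_gens_Suc_cases)
      case 1
      then show ?thesis
        using lmult_in_diff_ops_0 diff_ops_0_subset by blast
    next
      case (2 i a \<psi>)
      then have "\<psi> \<in> diff_ops r"
        using Suc by blast
      then show ?thesis
        unfolding 2(2) diff_ops.simps
        by (intro diff_stepI integrate_linear diff_ops_linear integrate_diff_ops)
    qed
  qed
qed

lemma left_D0_submodule_pdiff_hull: "left_D0_submodule (left_D0_submodule hull (pdiff_gens r))"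
  by (rule left_D0_submodule_hull[OF pdiff_gens_linear])

lemma diff_ops_0_subset_hull:
  "(diff_ops 0 :: (('k::field, 'n) free_alg \<Rightarrow> _) set) \<subseteq> left_D0_submodule hull (pdiff_gens r)"
proof
  fix \<delta> :: "('k, 'n) free_alg \<Rightarrow> ('k, 'n) free_alg"
  assume "\<delta> \<in> diff_ops 0"
  moreover have "lmult 1 \<in> left_D0_submodule hull (pdiff_gens r)"
    by (rule hull_inc) (simp add: pdiff_gens_def)
  ultimately have "\<delta> \<circ> lmult 1 \<in> left_D0_submodule hull (pdiff_gens r)"
    by (rule left_D0_submoduleD(5)[OF left_D0_submodule_pdiff_hull])
  then show "\<delta> \<in> left_D0_submodule hull (pdiff_gens r)"
    by (simp add: lmult_def comp_def)
qed

text \<open>The coefficient \<open>a\<close> is quantified inside the set \<open>?X\<close> because integration does not commute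
  with left multiplications: these are absorbed into \<open>a\<close> instead.\<close>

lemma integrate_hull:
  assumes "\<psi> \<in> left_D0_submodule hull (pdiff_gens r)"
  shows "integrate i a \<psi> \<in> left_D0_submodule hull (pdiff_gens (Suc r))"
proof -
  let ?M = "left_D0_submodule hull (pdiff_gens (Suc r))"
  let ?X = "{\<psi> \<in> linear_ops. \<forall>a. integrate i a \<psi> \<in> ?M}"
  note M = left_D0_submodule_pdiff_hull[of "Suc r"]
  have "left_D0_submodule ?X"
    by (rule left_D0_submoduleI)
      (auto simp: linear_ops_closed integrate_zero integrate_add integrate_minus integrate_left
        integrate_rmult intro: left_D0_submoduleD[OF M] left_D0_submodule_rmult[OF M])
  moreover have "pdiff_gens r \<subseteq> ?X"
    using pdiff_gens_linear by (auto intro: hull_inc pdiff_gens_integrate)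
  ultimately have "left_D0_submodule hull (pdiff_gens r) \<subseteq> ?X"
    by (intro hull_minimal)
  then show ?thesis
    using assms by blast
qed

text \<open>For a generator \<open>\<phi>\<close> one has \<open>\<phi>a = a\<phi> + [\<phi>, a]\<close>, and the bracket has lower order. The right
  action commutes with the left action of \<open>D\<^sup>0\<close>, so this passes to the whole module.\<close>

lemma hull_right_action:
  fixes \<phi> :: "('k::field, 'n) free_alg \<Rightarrow> ('k, 'n) free_alg"
  assumes IH: "(diff_ops r :: (('k, 'n) free_alg \<Rightarrow> _) set) =
      left_D0_submodule hull (pdiff_gens r)"
    and "\<phi> \<in> left_D0_submodule hull (pdiff_gens (Suc r))"
  shows "(\<lambda>s. \<phi> (a * s)) \<in> left_D0_submodule hull (pdiff_gens (Suc r))"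
proof -
  let ?M = "left_D0_submodule hull (pdiff_gens (Suc r) :: (('k, 'n) free_alg \<Rightarrow> _) set)"
  let ?X = "{\<phi> \<in> linear_ops. (\<lambda>s. \<phi> (a * s)) \<in> ?M}"
  note M = left_D0_submodule_pdiff_hull[of "Suc r"]
  have lower: "diff_ops r \<subseteq> ?M"
    unfolding IH by (rule hull_mono[OF pdiff_gens_mono])
  have "left_D0_submodule ?X"
    by (rule left_D0_submoduleI)
      (auto simp: linear_ops_closed intro: left_D0_submoduleD[OF M]
        left_D0_submodule_left[OF M] left_D0_submodule_rmult[OF M])
  moreover have "pdiff_gens (Suc r) \<subseteq> ?X"
  proof
    fix \<phi> :: "('k, 'n) free_alg \<Rightarrow> ('k, 'n) free_alg"
    assume \<phi>: "\<phi> \<in> pdiff_gens (Suc r)"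
    then have "bracket \<phi> a \<in> diff_ops r"
    proof (cases rule: pdiff_gens_Suc_cases)
      case 1
      then have "bracket \<phi> a = (\<lambda>_. 0)"
        by (simp add: bracket_def lmult_def)
      then show ?thesis
        using subbimoduleD(2)[OF subbimodule_diff_ops] by simp
    next
      case (2 i c \<psi>)
      then show ?thesis
        using integrate_diff_ops[OF subsetD[OF pdiff_gens_diff_ops 2(1)]] by simp
    qed
    then have "bracket \<phi> a \<in> ?M"
      using lower by blast
    then have "(\<lambda>s. a * \<phi> s + bracket \<phi> a s) \<in> ?M"
      by (rule left_D0_submoduleD(3)[OF M left_D0_submodule_left[OF M hull_inc[OF \<phi>]]])
    then show "\<phi> \<in> ?X"
      using \<phi> pdiff_gens_linear by (auto simp: bracket_def)
  qed
  ultimately have "?M \<subseteq> ?X"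
    by (intro hull_minimal)
  then show ?thesis
    using assms(2) by blast
qed

lemma diff_ops_eq_hull:
  "(diff_ops r :: (('k::field, 'n::finite) free_alg \<Rightarrow> ('k, 'n) free_alg) set) =
    left_D0_submodule hull (pdiff_gens r)"
proof (induction r)
  case 0
  show ?case
    using diff_ops_0_subset_hull[of 0] pdiff_gens_diff_ops[of 0] left_D0_submodule_diff_ops[of 0]
    by (intro subset_antisym hull_minimal)
next
  case (Suc r)
  let ?M = "left_D0_submodule hull (pdiff_gens (Suc r) :: (('k, 'n) free_alg \<Rightarrow> _) set)"
  note M = left_D0_submodule_pdiff_hull[of "Suc r"]
  have "subbimodule ?M"
    by (rule subbimoduleI)
      (rule left_D0_submoduleD(1-4)[OF M] left_D0_submodule_left[OF M]
        hull_right_action[OF Suc]; assumption)+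
  moreover have "{\<phi> \<in> linear_ops. \<forall>a. bracket \<phi> a \<in> diff_ops r} \<subseteq> ?M"
  proof (rule subsetI, elim CollectE conjE)
    fix \<phi> :: "('k, 'n) free_alg \<Rightarrow> ('k, 'n) free_alg"
    assume \<phi>: "\<phi> \<in> linear_ops" "\<forall>a. bracket \<phi> a \<in> diff_ops r"
    have "(\<lambda>s. s * \<phi> 1) \<in> ?M"
      using rmult_in_diff_ops_0[of "\<phi> 1"] diff_ops_0_subset_hull
      unfolding rmult_def by blast
    moreover have "integrate i 1 (bracket \<phi> (fvar i)) \<in> ?M" for i
      using \<phi>(2) Suc by (intro integrate_hull) auto
    ultimately have
      "(\<lambda>s. s * \<phi> 1 + (\<Sum>i\<in>UNIV. integrate i 1 (bracket \<phi> (fvar i)) s)) \<in> ?M"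
      by (intro left_D0_submoduleD(3)[OF M] left_D0_submodule_sum[OF M]) auto
    then show "\<phi> \<in> ?M"
      using bracket_decomposition[OF \<phi>(1)] by simp
  qed
  ultimately have "diff_ops (Suc r) \<subseteq> ?M"
    unfolding diff_ops.simps diff_step_def by (intro hull_minimal)
  moreover have "?M \<subseteq> diff_ops (Suc r)"
    by (intro hull_minimal pdiff_gens_diff_ops left_D0_submodule_diff_ops)
  ultimately show ?case ..
qed

theorem theorem3p3:
  fixes r :: nat
  assumes "CARD('n::finite) > 1"
    and "r \<ge> 1"
  shows "(diff_ops r :: (('k::field, 'n) free_alg \<Rightarrow> ('k, 'n) free_alg) set) =
    left_D0_submodule hull
      ({pdiff I J | I J. length I = length J \<and> 1 \<le> length I \<and> length I \<le> r} \<union> {lmult 1})"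
  using diff_ops_eq_hull[of r] unfolding pdiff_gens_def .

end
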